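(* The class of $\theta$-digraphs is determined by the complementarity spectrum (DCS): for every $n$, if $D$ and $H$ are $\theta$-digraphs, both with $n$ vertices, and $\Pi(D)=\Pi(H)$, then $D$ and $H$ are isomorphic.
   Context: Digraphs are finite and simple (no loops, no multiple arcs; opposite arcs are allowed). The adjacency matrix $A(D)=(a_{ij})$ of a digraph $D$ has $a_{ij}=1$ if $(i,j)$ is an arc and $a_{ij}=0$ otherwise. A real number $\lambda$ is a complementarity eigenvalue of a real $n\times n$ matrix $A$ if there is a nonzero vector $x\in\mathbb{R}^n$ with $x\ge 0$ (coordinatewise), $Ax\ge\lambda x$ and $\langle x,Ax-\lambda x\rangle=0$. The complementarity spectrum $\Pi(D)$ is the set (not multiset) of complementarity eigenvalues of $A(D)$; it does not depend on the vertex labelling. For integers $a,b,c\ge 0$ with $a\le b$ and $b>0$, the digraph $\theta(a,b,c)$ consists of three directed paths $\vec P_{a+2},\vec P_{b+2},\vec P_{c+2}$ (with $a+2$, $b+2$, $c+2$ vertices respectively), internally vertex-disjoint, such that the initial vertex of $\vec P_{a+2}$ and of $\vec P_{b+2}$ is the terminal vertex of $\vec P_{c+2}$, and the initial vertex of $\vec P_{c+2}$ is the terminal vertex of $\vec P_{a+2}$ and of $\vec P_{b+2}$. It has $n=a+b+c+2$ vertices. A $\theta$-digraph is a digraph isomorphic to some $\theta(a,b,c)$. A class of digraphs is DCS if any two digraphs of the class having the same number of vertices and the same complementarity spectrum are isomorphic. *)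

theory Defs
  imports "Graph_Theory.Graph_Theory" "Jordan_Normal_Form.Matrix"
begin

definition complementarity_eigenvalue :: "real mat \<Rightarrow> real \<Rightarrow> bool" where
  "complementarity_eigenvalue A \<mu> \<longleftrightarrow>
     (\<exists>x \<in> carrier_vec (dim_row A).
        x \<noteq> 0\<^sub>v (dim_row A) \<and>
        0\<^sub>v (dim_row A) \<le> x \<and>
        \<mu> \<cdot>\<^sub>v x \<le> A *\<^sub>v x \<and>
        scalar_prod x (A *\<^sub>v x - \<mu> \<cdot>\<^sub>v x) = 0)"

text \<open>The list \<open>vs\<close> is the vertex labelling: \<open>vs ! i\<close> is the vertex number \<open>i\<close>.\<close>

definition vertex_labelling :: "('a, 'b) pre_digraph \<Rightarrow> 'a list \<Rightarrow> bool" where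
  "vertex_labelling D vs \<longleftrightarrow> distinct vs \<and> set vs = verts D"

definition adjacency_matrix :: "('a, 'b) pre_digraph \<Rightarrow> 'a list \<Rightarrow> real mat" where
  "adjacency_matrix D vs = mat (length vs) (length vs)
     (\<lambda>(i, j). if (vs ! i, vs ! j) \<in> arcs_ends D then 1 else 0)"

text \<open>The existential quantifier over labellings is harmless: by
  \<open>complementarity_spectrum_labelling\<close> below, every labelling yields the same set.\<close>

definition complementarity_spectrum :: "('a, 'b) pre_digraph \<Rightarrow> real set" where
  "complementarity_spectrum D =
     {\<mu>. \<exists>vs. vertex_labelling D vs \<and> complementarity_eigenvalue (adjacency_matrix D vs) \<mu>}"

lemma complementarity_eigenvalue_relabel:
  assumes vs: "vertex_labelling D vs" and ws: "vertex_labelling D ws"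
    and ev: "complementarity_eigenvalue (adjacency_matrix D vs) \<mu>"
  shows "complementarity_eigenvalue (adjacency_matrix D ws) \<mu>"
proof -
  define n where "n = length vs"
  let ?A = "adjacency_matrix D vs" and ?B = "adjacency_matrix D ws"
  have len: "length ws = n"
    using vs ws unfolding vertex_labelling_def n_def by (metis distinct_card)
  have bv: "bij_betw ((!) vs) {..<n} (verts D)" and bw: "bij_betw ((!) ws) {..<n} (verts D)"
    using vs ws len unfolding vertex_labelling_def n_def by (auto intro!: bij_betw_nth)
  define p where "p = the_inv_into {..<n} ((!) vs) \<circ> (!) ws"
  have p: "bij_betw p {..<n} {..<n}"
    unfolding p_def using bw bij_betw_the_inv_into[OF bv] by (rule bij_betw_trans)
  have pn: "p i < n" if "i < n" for i
    using p that by (auto simp: bij_betw_def)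
  have pv: "vs ! p i = ws ! i" if "i < n" for i
    using f_the_inv_into_f_bij_betw[OF bv, of "ws ! i"] bw that
    by (auto simp: p_def bij_betw_def)
  have reidx: "(\<Sum>i = 0..<n. f (p i)) = (\<Sum>i = 0..<n. f i)" for f :: "nat \<Rightarrow> real"
    using sum.reindex_bij_betw[OF p, of f] by (simp add: atLeast0LessThan)
  have dA[simp]: "dim_row ?A = n" "dim_col ?A = n" and dB[simp]: "dim_row ?B = n" "dim_col ?B = n"
    by (auto simp: adjacency_matrix_def n_def len)
  have AB: "?B $$ (i, j) = ?A $$ (p i, p j)" if "i < n" "j < n" for i j
    using that pn pv len by (auto simp: adjacency_matrix_def n_def[symmetric])
  obtain x where x: "x \<in> carrier_vec n" "x \<noteq> 0\<^sub>v n" "0\<^sub>v n \<le> x" "\<mu> \<cdot>\<^sub>v x \<le> ?A *\<^sub>v x"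
    "scalar_prod x (?A *\<^sub>v x - \<mu> \<cdot>\<^sub>v x) = 0"
    using ev unfolding complementarity_eigenvalue_def by auto
  define y where "y = vec n (\<lambda>i. x $ p i)"
  have y: "y \<in> carrier_vec n" by (simp add: y_def)
  have yi: "y $ i = x $ p i" if "i < n" for i
    using that by (simp add: y_def)
  have By: "(?B *\<^sub>v y) $ i = (?A *\<^sub>v x) $ p i" if "i < n" for i
  proof -
    have "(?B *\<^sub>v y) $ i = (\<Sum>j = 0..<n. ?A $$ (p i, p j) * x $ p j)"
      using that y by (auto simp: scalar_prod_def y_def AB intro!: sum.cong)
    also have "\<dots> = (\<Sum>j = 0..<n. ?A $$ (p i, j) * x $ j)"
      by (rule reidx)
    also have "\<dots> = (?A *\<^sub>v x) $ p i"
      using pn[OF that] x(1) by (auto simp: scalar_prod_def intro!: sum.cong)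
    finally show ?thesis .
  qed
  have "y \<noteq> 0\<^sub>v n"
  proof
    assume y0: "y = 0\<^sub>v n"
    have "x $ k = 0" if "k < n" for k
    proof -
      have "k \<in> p ` {..<n}"
        unfolding bij_betw_imp_surj_on[OF p] using that by simp
      then obtain i where i: "i < n" "k = p i"
        by auto
      then have "y $ i = x $ k" by (simp add: y_def)
      then show ?thesis using y0 i by simp
    qed
    then have "x = 0\<^sub>v n" using x(1) by (intro eq_vecI) simp_all
    with x(2) show False by contradiction
  qed
  moreover have "0\<^sub>v n \<le> y"
    using x(1,3) pn by (auto simp: less_eq_vec_def y_def)
  moreover have "\<mu> \<cdot>\<^sub>v y \<le> ?B *\<^sub>v y"
    using x(1,4) pn By y by (auto simp: less_eq_vec_def y_def simp del: index_mult_mat_vec)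
  moreover have "scalar_prod y (?B *\<^sub>v y - \<mu> \<cdot>\<^sub>v y) = 0"
  proof -
    have "scalar_prod y (?B *\<^sub>v y - \<mu> \<cdot>\<^sub>v y)
        = (\<Sum>i = 0..<n. x $ p i * ((?A *\<^sub>v x) $ p i - \<mu> * x $ p i))"
      unfolding scalar_prod_def using y
      by (auto simp: By yi simp del: index_mult_mat_vec intro!: sum.cong)
    also have "\<dots> = (\<Sum>i = 0..<n. x $ i * ((?A *\<^sub>v x) $ i - \<mu> * x $ i))"
      by (rule reidx)
    also have "\<dots> = scalar_prod x (?A *\<^sub>v x - \<mu> \<cdot>\<^sub>v x)"
      unfolding scalar_prod_def using x(1)
      by (auto simp del: index_mult_mat_vec intro!: sum.cong)
    finally show ?thesis using x(5) by simp
  qed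
  ultimately show ?thesis
    unfolding complementarity_eigenvalue_def using y by auto
qed

lemma complementarity_spectrum_labelling:
  assumes "vertex_labelling D vs"
  shows "complementarity_spectrum D = {\<mu>. complementarity_eigenvalue (adjacency_matrix D vs) \<mu>}"
  using assms complementarity_eigenvalue_relabel
  unfolding complementarity_spectrum_def by blast

definition path_arcs :: "'a list \<Rightarrow> ('a \<times> 'a) set" where
  "path_arcs p = set (zip p (tl p))"

text \<open>
  Vertex \<open>0\<close> is the initial vertex of the paths with \<open>a + 2\<close> and \<open>b + 2\<close> vertices and the
  terminal vertex of the path with \<open>c + 2\<close> vertices; vertex \<open>1\<close> is the other common end vertex.
  The interiors of the three paths are consecutive blocks of lengths \<open>a\<close>, \<open>b\<close>, \<open>c\<close>.
\<close>

definition theta :: "nat \<Rightarrow> nat \<Rightarrow> nat \<Rightarrow> nat pair_pre_digraph" where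
  "theta a b c = \<lparr>
     pverts = {0..<a + b + c + 2},
     parcs = path_arcs (0 # [2..<2 + a] @ [1])
           \<union> path_arcs (0 # [2 + a..<2 + a + b] @ [1])
           \<union> path_arcs (1 # [2 + a + b..<2 + a + b + c] @ [0]) \<rparr>"

definition theta_digraph :: "('a, 'b) pre_digraph \<Rightarrow> bool" where
  "theta_digraph D \<longleftrightarrow>
     digraph D \<and> (\<exists>a b c. a \<le> b \<and> 0 < b \<and> digraph_iso D (with_proj (theta a b c)))"

lemma path_arcs_subset: "path_arcs p \<subseteq> set p \<times> set p"
  unfolding path_arcs_def
  by (cases p) (auto dest: set_zip_leftD set_zip_rightD)

lemma path_arcs_irrefl: "distinct p \<Longrightarrow> (v, v) \<notin> path_arcs p"
  by (auto simp: path_arcs_def in_set_zip nth_tl nth_eq_iff_index_eq)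

lemma digraph_theta: "digraph (with_proj (theta a b c))"
proof -
  let ?p = "0 # [2..<2 + a] @ [1]" and ?q = "0 # [2 + a..<2 + a + b] @ [1]"
    and ?r = "1 # [2 + a + b..<2 + a + b + c] @ [0]"
  have sub: "parcs (theta a b c) \<subseteq> pverts (theta a b c) \<times> pverts (theta a b c)"
  proof -
    have "set ?p \<subseteq> {0..<a + b + c + 2}" "set ?q \<subseteq> {0..<a + b + c + 2}" "set ?r \<subseteq> {0..<a + b + c + 2}"
      by auto
    then have "path_arcs ?p \<subseteq> {0..<a + b + c + 2} \<times> {0..<a + b + c + 2}"
      "path_arcs ?q \<subseteq> {0..<a + b + c + 2} \<times> {0..<a + b + c + 2}"
      "path_arcs ?r \<subseteq> {0..<a + b + c + 2} \<times> {0..<a + b + c + 2}"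
      using path_arcs_subset by (blast intro: order_trans)+
    then show ?thesis unfolding theta_def by simp
  qed
  have dist: "distinct ?p" "distinct ?q" "distinct ?r" by auto
  have irr: "(v, v) \<notin> parcs (theta a b c)" for v
    unfolding theta_def using dist[THEN path_arcs_irrefl] by simp
  have fin: "finite (pverts (theta a b c))" by (simp add: theta_def)
  show ?thesis
  proof unfold_locales
    show "finite (arcs (with_proj (theta a b c)))"
      using finite_subset[OF sub] fin by simp
  qed (use sub irr fin in \<open>auto simp: arc_to_ends_def\<close>)
qed

lemma theta_digraph_theta: "a \<le> b \<Longrightarrow> 0 < b \<Longrightarrow> theta_digraph (with_proj (theta a b c))"
proof -
  assume ab: "a \<le> b" "0 < b"
  interpret digraph "with_proj (theta a b c)" by (rule digraph_theta)
  have "digraph_iso (with_proj (theta a b c)) (with_proj (theta a b c))"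
    unfolding digraph_iso_def
    by (rule exI[where x = "\<lparr>iso_verts = id, iso_arcs = id, iso_head = snd, iso_tail = fst\<rparr>"])
      (auto simp: pre_digraph.digraph_isomorphism_def app_iso_def with_proj_def
        wf_digraph[unfolded with_proj_def])
  then show ?thesis
    unfolding theta_digraph_def using ab digraph_theta by blast
qed

lemma card_verts_theta: "card (verts (with_proj (theta a b c))) = a + b + c + 2"
  by (simp add: theta_def)

end

theory Submission
  imports Defs "HOL-Computational_Algebra.Computational_Algebra" "Jordan_Normal_Form.Char_Poly"
begin

text \<open>
  The spectrum of \<open>\<theta>(a,b,c)\<close> contains exactly one number \<open>\<mu> > 1\<close>. It belongs to the whole digraph,
  all of whose other induced strongly connected subdigraphs are cycles or single vertices, and it is
  characterised by \<open>x^p + x^q = 1\<close> with \<open>x = 1/\<mu>\<close>, where \<open>p = a + c + 2\<close> and \<open>q = b + c + 2\<close>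
  are the lengths of the two cycles (lemma \<open>spectrum_theta_gt_one\<close>). Together with
  \<open>n = a + b + c + 2\<close> the lengths \<open>p\<close> and \<open>q\<close> determine \<open>a\<close>, \<open>b\<close> and \<open>c\<close>. So the question
  is whether \<open>x\<close> determines \<open>p\<close> and \<open>q\<close>: can two different polynomials \<open>f = x^q + x^p - 1\<close>
  and \<open>g = x^q' + x^p' - 1\<close> have a common root between 0 and 1?

  This is decided by Ljunggren's method for the factorisation of trinomials. Let \<open>h\<close> be a common
  integer factor of \<open>f\<close> and \<open>g\<close> with this root, and let a star denote reciprocal polynomials.
  If \<open>f = h k\<close>, then \<open>F = h k*\<close> satisfies \<open>F F* = f f*\<close>, and comparing coefficients shows that
  such an \<open>F\<close> is \<open>\<plusminus>f\<close> or \<open>\<plusminus>f*\<close> (lemma \<open>ljunggren_trinomial\<close>). As \<open>f\<close> has no root at \<open>1/x\<close>,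
  this forces \<open>k* = \<plusminus>k\<close>; the cofactor of \<open>h\<close> in \<open>g\<close> is self-reciprocal up to sign for the same
  reason. Therefore \<open>f* g = \<plusminus>f g*\<close>, and the exponents in this identity leave only the family
  \<open>(p, q) = (d, 5d)\<close>, \<open>(p', q') = (2d, 3d)\<close> (lemma \<open>trinomials_common_root\<close>). For equal numbers
  of vertices that family is excluded, because a cycle has at most \<open>n\<close> vertices, whereas
  \<open>p' + q' = n + c' + 2\<close>.
\<close>

section \<open>Integer trinomials with a common root\<close>

abbreviation root_at :: "int poly \<Rightarrow> real \<Rightarrow> bool" where
  "root_at f x \<equiv> poly (of_int_poly f) x = 0"

text \<open>
  Gauss's lemma: contents are multiplicative, so the scalar factor sits entirely in the
  cofactor of \<open>h\<close> and can be cancelled there.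
\<close>

lemma dvd_of_dvd_smult_primitive:
  fixes h f :: "int poly"
  assumes "content h = 1" "a \<noteq> 0" "h dvd smult a f"
  shows "h dvd f"
proof -
  obtain s where s: "smult a f = h * s" using assms(3) by (auto elim: dvdE)
  have "content (smult a f) = content s" by (simp add: s content_mult assms(1))
  then have "a dvd content s" by (metis content_smult dvd_normalize_iff dvd_refl dvd_triv_left dvd_mult2 normalize_dvd_iff)
  then have "[:a:] dvd s" by (simp add: const_poly_dvd_iff_dvd_content)
  then obtain s' where s': "s = smult a s'" by (auto elim: dvdE)
  have "smult a f = smult a (h * s')" using s s' by simp
  then have "f = h * s'" using assms(2) by (simp add: poly_eq_iff)
  then show ?thesis by simp
qed

text \<open>
  The common factor is the primitive integer polynomial of least degree that vanishes at \<open>x\<close>.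
  Pseudo-division of any other polynomial with root \<open>x\<close> leaves a remainder that vanishes at
  \<open>x\<close> and has smaller degree, hence is zero, and the leading coefficient that pseudo-division
  introduces is removed by Gauss's lemma.
\<close>

lemma common_root_common_factor:
  fixes f g :: "int poly"
  assumes "f \<noteq> 0" "root_at f x" "root_at g x"
  obtains h where "h dvd f" "h dvd g" "root_at h x"
proof -
  let ?P = "\<lambda>d. \<exists>h. h \<noteq> 0 \<and> root_at h x \<and> degree h = d"
  obtain d where "?P d" and least: "\<And>d'. ?P d' \<Longrightarrow> d \<le> d'"
    using assms LeastI[of ?P "degree f"] Least_le[of ?P] by blast
  then obtain h' where h': "h' \<noteq> 0" "root_at h' x" "degree h' = d" by blast
  define h where "h = primitive_part h'"
  have "h' = smult (content h') h" by (simp add: h_def)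
  then have "poly (of_int_poly h') x = content h' * poly (of_int_poly h) x"
    by (metis of_int_hom.map_poly_hom_smult poly_smult)
  then have h: "content h = 1" "root_at h x" "degree h = d" "h \<noteq> 0"
    using h' by (auto simp: h_def)
  have "h dvd F" if F: "root_at F x" for F
  proof -
    obtain a s where as: "a \<noteq> 0" "smult a F = h * s + pseudo_mod F h"
      using pseudo_mod(1)[OF h(4), of F] by blast
    have "poly (of_int_poly (smult a F)) x = poly (of_int_poly (h * s + pseudo_mod F h)) x"
      using as by simp
    then have "root_at (pseudo_mod F h) x"
      using F h(2) by (simp add: of_int_poly_hom.hom_add of_int_poly_hom.hom_mult of_int_hom.map_poly_hom_smult)
    then have "pseudo_mod F h = 0"
      using pseudo_mod(2)[OF h(4), of F] least[of "degree (pseudo_mod F h)"] h(3) by force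
    then have "h dvd smult a F" using as by simp
    then show ?thesis using h(1) as(1) by (rule dvd_of_dvd_smult_primitive[rotated 2])
  qed
  then show ?thesis using that assms h(2) by blast
qed

text \<open>
  For integer coefficients this middle coefficient is what makes Ljunggren's argument work: if it
  is small, \<open>F\<close> can only have very few nonzero coefficients.
\<close>

lemma coeff_times_reflect_poly_degree:
  fixes F :: "int poly"
  shows "coeff (F * reflect_poly F) (degree F) = (\<Sum>i\<le>degree F. (coeff F i)\<^sup>2)"
  by (auto simp: coeff_mult coeff_reflect_poly power2_eq_square intro!: sum.cong)

text \<open>
  For \<open>p = q\<close> this is the binomial \<open>2 x^q - 1\<close>. That case is kept, because it belongs to
  \<open>\<theta>(a,b,c)\<close> with \<open>a = b\<close>.
\<close>

definition trinomial :: "nat \<Rightarrow> nat \<Rightarrow> int poly" where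
  "trinomial p q = monom 1 q + monom 1 p - 1"

lemma coeff_trinomial:
  "coeff (trinomial p q) n = of_bool (n = q) + of_bool (n = p) - of_bool (n = 0)"
  by (auto simp: trinomial_def)

lemma degree_trinomial: "0 < p \<Longrightarrow> p \<le> q \<Longrightarrow> degree (trinomial p q) = q"
  by (intro antisym degree_le le_degree) (auto simp: coeff_trinomial)

lemma reflect_trinomial:
  assumes "0 < p" "p \<le> q"
  shows "reflect_poly (trinomial p q) = 1 + monom 1 (q - p) - monom 1 q"
  using assms by (intro poly_eqI) (auto simp: coeff_reflect_poly coeff_trinomial degree_trinomial)

lemma trinomial_times_reflect:
  assumes "0 < p" "p \<le> q"
  shows "trinomial p q * reflect_poly (trinomial p q) =
    - 1 + monom 1 p - monom 1 (q - p) + monom 3 q + monom 1 (2 * q - p)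
    - monom 1 (q + p) - monom 1 (2 * q)"
proof -
  have [simp]: "p + (q - p) = q" "q + (q - p) = 2 * q - p" "q + q = 2 * q" using assms by auto
  have m3: "monom (3::int) q = monom 1 q + monom 1 q + monom 1 q" by (simp add: add_monom)
  show ?thesis
    unfolding reflect_trinomial[OF assms] unfolding trinomial_def m3
    by (simp add: algebra_simps mult_monom)
qed

lemma sum_squares_eq_one:
  fixes c :: "'i \<Rightarrow> int"
  assumes "finite I" "(\<Sum>i\<in>I. (c i)\<^sup>2) = 1"
  obtains m where "m \<in> I" "\<bar>c m\<bar> = 1" "\<And>i. i \<in> I \<Longrightarrow> i \<noteq> m \<Longrightarrow> c i = 0"
proof -
  have "\<exists>m\<in>I. c m \<noteq> 0" by (rule ccontr) (use assms(2) in simp)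
  then obtain m where m: "m \<in> I" "c m \<noteq> 0" by blast
  have split: "(c m)\<^sup>2 + (\<Sum>i\<in>I - {m}. (c i)\<^sup>2) = 1"
    using assms m(1) by (simp add: sum.remove)
  have "(c m)\<^sup>2 > 0" using m(2) by simp
  moreover have "(\<Sum>i\<in>I - {m}. (c i)\<^sup>2) \<ge> 0" by (simp add: sum_nonneg)
  ultimately have sq: "(c m)\<^sup>2 = 1" "(\<Sum>i\<in>I - {m}. (c i)\<^sup>2) = 0" using split by linarith+
  have "\<bar>c m\<bar> = 1" using sq(1) by (simp add: abs_square_eq_1)
  moreover have "\<forall>i\<in>I - {m}. (c i)\<^sup>2 = 0"
    using sq(2) assms(1) by (subst (asm) sum_nonneg_eq_0_iff) auto
  ultimately show ?thesis using that m(1) by auto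
qed

text \<open>
  Ljunggren's argument. Write \<open>f\<close> for the trinomial and \<open>f*\<close> for its reciprocal. The product
  \<open>F F*\<close> determines the sum of the squares of the coefficients of \<open>F\<close>, which is 3 (or 5 if \<open>p = q\<close>),
  and the product of the first and the last one, which is -1 (or -2). Hence \<open>F\<close> is, up to sign,
  \<open>x^q + e x^m - 1\<close> with \<open>e = 1\<close> or \<open>e = -1\<close> (or has just its two extreme terms), and the
  remaining coefficients of \<open>F F*\<close> give \<open>e = 1\<close>, \<open>m = p\<close>, which is \<open>f\<close>, or \<open>e = -1\<close>,
  \<open>m = q - p\<close>, which is \<open>-f*\<close>.
\<close>

lemma ljunggren_trinomial:
  fixes F :: "int poly"
  assumes pq: "0 < p" "p \<le> q" and deg: "degree F = q"
    and FF: "F * reflect_poly F = trinomial p q * reflect_poly (trinomial p q)"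
  shows "F = trinomial p q \<or> F = - trinomial p q \<or>
    F = reflect_poly (trinomial p q) \<or> F = - reflect_poly (trinomial p q)"
proof -
  define a b where "a = coeff F 0" and "b = coeff F q"
  have coeff_FF: "coeff (F * reflect_poly F) n =
    3 * of_bool (n = q) - of_bool (n = 0) + of_bool (n = p) - of_bool (n = q - p)
    + of_bool (n = 2 * q - p) - of_bool (n = q + p) - of_bool (n = 2 * q)" for n
    unfolding FF trinomial_times_reflect[OF pq] by auto
  have ab: "a * b = - 1 - of_bool (p = q)"
    using coeff_FF[of 0] pq deg by (auto simp: coeff_mult a_def b_def)
  have bmid: "{..q} = insert 0 (insert q {0<..<q})" using pq by auto
  have squares: "a\<^sup>2 + b\<^sup>2 + (\<Sum>i\<in>{0<..<q}. (coeff F i)\<^sup>2) = 3 + 2 * of_bool (p = q)"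
    using coeff_FF[of q] pq coeff_times_reflect_poly_degree[of F]
    unfolding deg bmid by (auto simp: a_def b_def of_bool_def split: if_splits)
  have outside: "coeff F i = 0" if "i > q" for i using that deg by (simp add: coeff_eq_0)
  show ?thesis
  proof (cases "p = q")
    case True
    then have "a * b = -2" using ab by simp
    then have "a dvd 2" by (metis dvd_minus_iff dvd_triv_left)
    then have "\<bar>a\<bar> \<le> 2" "a \<noteq> 0"
      using zdvd_imp_le[of "\<bar>a\<bar>" 2] by auto
    then have "a = 1 \<or> a = -1 \<or> a = 2 \<or> a = -2"
      by presburger
    then have abs: "(a = 1 \<and> b = -2) \<or> (a = -1 \<and> b = 2) \<or> (a = 2 \<and> b = -1) \<or> (a = -2 \<and> b = 1)"
      using \<open>a * b = -2\<close> by auto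
    then have "(\<Sum>i\<in>{0<..<q}. (coeff F i)\<^sup>2) = 0" using squares True by auto
    then have "\<forall>i\<in>{0<..<q}. (coeff F i)\<^sup>2 = 0"
      by (subst (asm) sum_nonneg_eq_0_iff) auto
    then have coeff_F: "coeff F i = a * of_bool (i = 0) + b * of_bool (i = q)" for i
      using outside[of i] pq by (cases i q rule: linorder_cases) (auto simp: a_def b_def)
    have coeff_f: "coeff (trinomial p q) i = 2 * of_bool (i = q) - of_bool (i = 0)" for i
      using True by (simp add: coeff_trinomial)
    have coeff_f': "coeff (reflect_poly (trinomial p q)) i = 2 * of_bool (i = 0) - of_bool (i = q)" for i
      unfolding reflect_trinomial[OF pq] using True
      by (auto simp: numeral_poly coeff_pCons split: nat.split)
    show ?thesis
      using abs
    proof (elim disjE conjE)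
      assume "a = 1" "b = -2"
      then have "F = - trinomial p q" by (intro poly_eqI) (simp add: coeff_F coeff_f)
      then show ?thesis by simp
    next
      assume "a = -1" "b = 2"
      then have "F = trinomial p q" by (intro poly_eqI) (simp add: coeff_F coeff_f)
      then show ?thesis by simp
    next
      assume "a = 2" "b = -1"
      then have "F = reflect_poly (trinomial p q)" by (intro poly_eqI) (simp add: coeff_F coeff_f')
      then show ?thesis by simp
    next
      assume "a = -2" "b = 1"
      then have "F = - reflect_poly (trinomial p q)" by (intro poly_eqI) (simp add: coeff_F coeff_f')
      then show ?thesis by simp
    qed
  next
    case False
    then have "a * b = -1" using ab by simp
    then have ab1: "(a = 1 \<and> b = -1) \<or> (a = -1 \<and> b = 1)"
      by (metis add.inverse_inverse minus_mult_minus mult_minus_right pos_zmult_eq_1_iff_lemma zmult_eq_1_iff)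
    then have "(\<Sum>i\<in>{0<..<q}. (coeff F i)\<^sup>2) = 1" using squares False by auto
    then obtain m where m: "m \<in> {0<..<q}" "\<bar>coeff F m\<bar> = 1"
      "\<And>i. i \<in> {0<..<q} \<Longrightarrow> i \<noteq> m \<Longrightarrow> coeff F i = 0"
      using sum_squares_eq_one by (metis finite_greaterThanLessThan)
    obtain e where e: "coeff F m = b * e" "e = 1 \<or> e = -1"
      using ab1 m(2) by (metis abs_eq_iff' abs_1 minus_minus mult_1 mult_1_right mult_minus1)
    have coeff_F: "coeff F i = b * (of_bool (i = q) + e * of_bool (i = m) - of_bool (i = 0))" for i
      using outside[of i] pq m e ab1
      by (cases i q rule: linorder_cases; cases "i = 0"; cases "i = m") (auto simp: a_def b_def)
    have F: "F = smult b (monom 1 q + monom e m - 1)"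
      by (intro poly_eqI) (auto simp: coeff_F)
    have bb: "b * b = 1" using ab1 by auto
    have refl: "reflect_poly F = smult b (1 + monom e (q - m) - monom 1 q)"
      using m(1) by (intro poly_eqI) (auto simp: coeff_reflect_poly deg coeff_F)
    have [simp]: "m + (q - m) = q" using m by auto
    have ee: "e * e = 1" using e by auto
    have "F * reflect_poly F = smult (b * b) ((monom 1 q + monom e m - 1) * (1 + monom e (q - m) - monom 1 q))"
      unfolding refl by (subst F) simp
    also have "\<dots> = monom 1 q + monom e (q + (q - m)) - monom 1 (q + q) + monom e m + monom 1 q
       - monom e (q + m) - 1 - monom e (q - m) + monom 1 q"
      unfolding bb by (simp add: algebra_simps mult_monom ee)
    finally have product: "F * reflect_poly F = monom 1 q + monom e (q + (q - m)) - monom 1 (q + q)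
       + monom e m + monom 1 q - monom e (q + m) - 1 - monom e (q - m) + monom 1 q" .
    have "coeff (F * reflect_poly F) n = 3 * of_bool (q = n) + e * of_bool (q + (q - m) = n)
        - of_bool (q + q = n) + e * of_bool (m = n) - e * of_bool (q + m = n) - of_bool (0 = n)
        - e * of_bool (q - m = n)" for n
      unfolding product coeff_add coeff_diff coeff_monom
      by (simp add: of_bool_def)
    note coeff_product = this
    have cmp: "e * of_bool (m = n) - e * of_bool (q - m = n) = of_bool (n = p) - of_bool (n = q - p)"
      if n: "0 < n" "n < q" for n
    proof -
      have [simp]: "0 \<noteq> n" "q \<noteq> n" "q + q \<noteq> n" "q + m \<noteq> n" "q + (q - m) \<noteq> n"
        "n \<noteq> 0" "n \<noteq> q" "n \<noteq> 2 * q - p" "n \<noteq> q + p" "n \<noteq> 2 * q"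
        using n m(1) pq by auto
      show ?thesis using coeff_product[of n] coeff_FF[of n] by simp
    qed
    \<comment> \<open>If \<open>q = 2p\<close>, the two middle terms of \<open>f f*\<close> cancel, so \<open>m = p\<close> and both signs are possible.\<close>
    have "(e = 1 \<and> m = p) \<or> (e = -1 \<and> m = q - p)"
    proof (cases "2 * p = q")
      case True
      then have "m = p" using cmp[of m] m(1) pq e(2) by (auto split: if_splits)
      then show ?thesis using True e(2) by auto
    next
      case neq: False
      then show ?thesis using cmp[of p] m(1) pq e(2) False by (auto simp: of_bool_def split: if_splits)
    qed
    then show ?thesis
      using ab1 unfolding F reflect_trinomial[OF pq]
      by (elim disjE conjE) (auto simp: trinomial_def minus_monom[symmetric] algebra_simps)
  qed
qed

lemma root_at_trinomial: "root_at (trinomial p q) x \<longleftrightarrow> x ^ q + x ^ p = 1"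
  by (auto simp: trinomial_def of_int_poly_hom.hom_minus of_int_poly_hom.hom_add poly_monom)

lemma of_int_poly_reflect:
  "of_int_poly (reflect_poly h) = reflect_poly (of_int_poly h :: real poly)"
  by (intro poly_eqI) (simp add: coeff_reflect_poly)

text \<open>
  Replacing the factor \<open>k\<close> of \<open>f = h k\<close> by its reciprocal \<open>k*\<close> does not change the product of the
  polynomial with its reciprocal, so Ljunggren's argument gives \<open>h k* = \<plusminus>h k\<close> or
  \<open>h k* = \<plusminus>h* k*\<close>. In the second case \<open>h = \<plusminus>h*\<close> would vanish at \<open>1/x\<close> as well; but \<open>f\<close> is
  positive there, as \<open>1/x > 1\<close>.
\<close>

lemma trinomial_cofactor_self_reciprocal:
  assumes pq: "0 < p" "p \<le> q" and x: "0 < x" "x < 1"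
    and fact: "trinomial p q = h * k" and root: "root_at h x"
  shows "reflect_poly k = k \<or> reflect_poly k = - k"
proof -
  let ?f = "trinomial p q"
  have "coeff h 0 * coeff k 0 = coeff ?f 0" by (simp add: fact coeff_mult)
  then have c0: "coeff h 0 \<noteq> 0" "coeff k 0 \<noteq> 0" using pq by (auto simp: coeff_trinomial)
  then have nz: "h \<noteq> 0" "k \<noteq> 0" by auto
  have inv: "poly (of_int_poly ?f) (inverse x) > (0::real)"
  proof -
    have "inverse x ^ q \<ge> 1" "inverse x ^ p \<ge> 1" using x by (auto simp: one_le_inverse)
    then show ?thesis
      by (simp add: trinomial_def of_int_poly_hom.hom_minus of_int_poly_hom.hom_add poly_monom)
  qed
  have not_h: "reflect_poly h \<noteq> h" "reflect_poly h \<noteq> - h"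
  proof -
    have "poly (of_int_poly (reflect_poly h)) x = x ^ degree h * poly (of_int_poly h) (inverse x)"
      using x poly_reflect_poly_nz[of x "of_int_poly h"] by (simp add: of_int_poly_reflect)
    moreover have "poly (of_int_poly h) (inverse x) \<noteq> (0::real)"
      using inv by (auto simp: fact of_int_poly_hom.hom_mult)
    ultimately have "\<not> root_at (reflect_poly h) x" using x by simp
    then show "reflect_poly h \<noteq> h" "reflect_poly h \<noteq> - h"
      using root by (auto simp: of_int_poly_hom.hom_uminus)
  qed
  define F where "F = h * reflect_poly k"
  have "degree F = degree ?f" using nz c0 by (simp add: F_def fact degree_mult_eq)
  then have "degree F = q" using pq by (simp add: degree_trinomial)
  moreover have "F * reflect_poly F = ?f * reflect_poly ?f"
    using c0 by (simp add: F_def fact reflect_poly_mult ac_simps)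
  ultimately have "F = ?f \<or> F = - ?f \<or> F = reflect_poly ?f \<or> F = - reflect_poly ?f"
    using ljunggren_trinomial[OF pq] by blast
  then have "h * reflect_poly k = h * k \<or> h * reflect_poly k = h * (- k) \<or>
     h * reflect_poly k = reflect_poly h * reflect_poly k \<or>
     h * reflect_poly k = (- reflect_poly h) * reflect_poly k"
    by (simp add: F_def fact reflect_poly_mult)
  then show ?thesis using nz not_h by (auto simp del: mult_minus_left mult_minus_right)
qed

text \<open>
  Let \<open>f = h k\<close> and \<open>g = h l\<close> be the two trinomials and \<open>h\<close> a common factor vanishing at \<open>x\<close>.
  Since \<open>k\<close> and \<open>l\<close> are self-reciprocal up to sign, \<open>f* g\<close> and \<open>f g*\<close> both are
  \<open>\<plusminus>h h* k l\<close>. This identity between explicit polynomials leaves, after cancellation, the equality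
  of two multisets of five exponents, which is solved by hand.
  
  The exceptional family does occur: \<open>x^5 + x - 1 = (x^3 + x^2 - 1) (x^2 - x + 1)\<close>.
\<close>

lemma trinomials_common_root:
  fixes x :: real
  assumes pq: "0 < p" "p \<le> q" and pq': "p < p'" "p' \<le> q'" "q' < q"
    and x: "0 < x" "x < 1" and eq: "x ^ p + x ^ q = 1" "x ^ p' + x ^ q' = 1"
  shows "p' = 2 * p \<and> q' = 3 * p \<and> q = 5 * p"
proof -
  let ?f = "trinomial p q" and ?g = "trinomial p' q'"
  have pos': "0 < p'" using pq pq' by auto
  have roots: "root_at ?f x" "root_at ?g x" using eq by (auto simp: root_at_trinomial)
  have nz: "?f \<noteq> 0"
    using coeff_trinomial[of p q 0] pq by auto
  obtain h where h: "h dvd ?f" "h dvd ?g" "root_at h x"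
    using common_root_common_factor[OF nz roots] by blast
  obtain k l where kl: "?f = h * k" "?g = h * l" using h by (auto elim!: dvdE)
  have k: "reflect_poly k = k \<or> reflect_poly k = - k"
    by (rule trinomial_cofactor_self_reciprocal[OF pq x kl(1) h(3)])
  have l: "reflect_poly l = l \<or> reflect_poly l = - l"
    by (rule trinomial_cofactor_self_reciprocal[OF pos' pq'(2) x kl(2) h(3)])
  have "reflect_poly ?f * ?g = ?f * reflect_poly ?g \<or> reflect_poly ?f * ?g = - (?f * reflect_poly ?g)"
    using k l unfolding kl reflect_poly_mult by (elim disjE) (auto simp: ac_simps)
  then have swap: "reflect_poly ?f * ?g = ?f * reflect_poly ?g"
  proof
    assume "reflect_poly ?f * ?g = - (?f * reflect_poly ?g)"
    then have "coeff (reflect_poly ?f * ?g) 0 = coeff (- (?f * reflect_poly ?g)) 0" by simp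
    then show ?thesis
      using pq pq' by (simp add: coeff_mult degree_trinomial coeff_trinomial of_bool_def split: if_splits)
  qed auto
  \<comment> \<open>Instances of the equality of exponents are compared through \<open>N n m\<close>, which is 1 if \<open>n = m\<close> and 0 otherwise.\<close>
  define N :: "nat \<Rightarrow> nat \<Rightarrow> int" where "N n m = coeff (monom 1 m) n" for n m
  have expanded: "monom 1 p' + monom 1 (q - p + q') + monom 1 (q - p + p') + monom 1 (q' - p') + monom 1 (q' + p)
    = monom 1 p + monom (1::int) (q' - p' + q) + monom 1 (q' - p' + p) + monom 1 (q - p) + monom 1 (q + p')"
    using swap unfolding reflect_trinomial[OF pq] reflect_trinomial[OF pos' pq'(2)]
    unfolding trinomial_def by (simp add: algebra_simps mult_monom)
  then have exps: "N n p' + N n (q - p + q') + N n (q - p + p') + N n (q' - p') + N n (q' + p)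
    = N n p + N n (q' - p' + q) + N n (q' - p' + p) + N n (q - p) + N n (q + p')" for n
    unfolding N_def coeff_add[symmetric] by (simp only: expanded)
  \<comment> \<open>The exponent \<open>p\<close> occurs on the right, and on the left only \<open>q' - p'\<close> can be equal to it.\<close>
  have "N p p > 0" "N p p' = 0" "N p (q - p + q') = 0" "N p (q - p + p') = 0" "N p (q' + p) = 0"
    using pq pq' by (auto simp: N_def)
  moreover have "N p n \<ge> 0" for n by (simp add: N_def)
  ultimately have "N p (q' - p') \<noteq> 0"
    using exps[of p] by (smt (verit, best))
  then have q': "q' = p + p'" using pq' by (auto simp: N_def split: if_splits)
  have exps': "N n p' + N n (q - p + p') + N n (p' + 2 * p) = N n (q + p) + N n (2 * p) + N n (q - p)" for n
  proof -
    have "q - p + q' = q + p'" "q' - p' + q = q + p" "q' - p' + p = 2 * p" "q' + p = p' + 2 * p" "q' - p' = p"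
      using q' pq pq' by auto
    then show ?thesis using exps[of n] by (simp add: mult_2 mult_2_right ac_simps)
  qed
  have "p' = 2 * p \<or> p' = q - p"
    using exps'[of p'] pq pq' by (auto simp: N_def of_bool_def split: if_splits)
  then have "p' = 2 * p"
    using exps'[of "2 * p"] pq pq' by (auto simp: N_def of_bool_def split: if_splits)
  moreover from this have "q = 5 * p"
    using exps'[of "4 * p"] pq pq' q' by (auto simp: N_def of_bool_def split: if_splits)
  ultimately show ?thesis using q' by simp
qed

section \<open>Complementarity eigenvalues greater than one\<close>

lemma digraph_iso_spectrum_subset:
  assumes wf: "wf_digraph D" and iso: "digraph_iso D H"
  shows "complementarity_spectrum D \<subseteq> complementarity_spectrum H"
proof
  fix \<mu> assume "\<mu> \<in> complementarity_spectrum D"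
  then obtain vs where vs: "vertex_labelling D vs"
    and ev: "complementarity_eigenvalue (adjacency_matrix D vs) \<mu>"
    by (auto simp: complementarity_spectrum_def)
  obtain \<phi> where iso: "pre_digraph.digraph_isomorphism D \<phi>" and H: "H = app_iso \<phi> D"
    using iso by (auto simp: digraph_iso_def)
  let ?f = "iso_verts \<phi>"
  have inj: "inj_on ?f (verts D)"
    using iso by (simp add: pre_digraph.digraph_isomorphism_def)
  have "vertex_labelling H (map ?f vs)"
    using vs inj by (simp add: vertex_labelling_def distinct_map H)
  moreover have "adjacency_matrix H (map ?f vs) = adjacency_matrix D vs"
  proof (rule eq_matI)
    fix i j assume "i < dim_row (adjacency_matrix D vs)" "j < dim_col (adjacency_matrix D vs)"
    then have ij: "i < length vs" "j < length vs" by (simp_all add: adjacency_matrix_def)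
    then have v: "vs ! i \<in> verts D" "vs ! j \<in> verts D"
      using vs nth_mem[of i vs] nth_mem[of j vs] by (simp_all add: vertex_labelling_def)
    have "(?f (vs ! i), ?f (vs ! j)) \<in> arcs_ends H \<longleftrightarrow> (vs ! i, vs ! j) \<in> arcs_ends D"
      unfolding H wf_digraph.arcs_ends_app_iso_eq[OF wf iso]
    proof
      assume "(?f (vs ! i), ?f (vs ! j)) \<in> (\<lambda>(u, v). (?f u, ?f v)) ` arcs_ends D"
      then obtain u w where uw: "(u, w) \<in> arcs_ends D" "?f (vs ! i) = ?f u" "?f (vs ! j) = ?f w"
        by auto
      moreover have "u \<in> verts D" "w \<in> verts D"
        using uw(1) wf wf_digraph.adj_in_verts by fastforce+
      ultimately show "(vs ! i, vs ! j) \<in> arcs_ends D"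
        using inj_onD[OF inj] v by metis
    qed (auto intro: rev_image_eqI)
    then show "adjacency_matrix H (map ?f vs) $$ (i, j) = adjacency_matrix D vs $$ (i, j)"
      using ij by (simp add: adjacency_matrix_def)
  qed (simp_all add: adjacency_matrix_def)
  ultimately show "\<mu> \<in> complementarity_spectrum H"
    using ev by (auto simp: complementarity_spectrum_def)
qed

lemma digraph_iso_spectrum_eq:
  assumes "wf_digraph D" "wf_digraph H" "digraph_iso D H"
  shows "complementarity_spectrum D = complementarity_spectrum H"
proof (rule antisym)
  show "complementarity_spectrum D \<subseteq> complementarity_spectrum H"
    by (rule digraph_iso_spectrum_subset[OF assms(1,3)])
  show "complementarity_spectrum H \<subseteq> complementarity_spectrum D"
    by (rule digraph_iso_spectrum_subset[OF assms(2) digraph_iso_swap[OF assms(1,3)]])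
qed

text \<open>
  The path consists of a start vertex, the block of \<open>k\<close> consecutive vertices from \<open>l\<close> on, and the
  end \<open>t\<close>. The indices count from the vertex after the start vertex, so that all indices \<open>i < k\<close>
  belong to vertices with exactly one out-neighbour, the path vertex with index \<open>i + 1\<close>.
\<close>

definition path_vertex :: "nat \<Rightarrow> nat \<Rightarrow> nat \<Rightarrow> nat \<Rightarrow> nat" where
  "path_vertex l k t i = (if i < k then l + i else t)"

lemma path_arcs_interval:
  "path_arcs (s # [l..<l + k] @ [t]) = insert (s, path_vertex l k t 0) ((\<lambda>i. (l + i, path_vertex l k t (Suc i))) ` {..<k})"
proof -
  have "zip (s # [l..<l + k] @ [t]) ([l..<l + k] @ [t])
     = map (\<lambda>i. (if i = 0 then s else l + (i - 1), path_vertex l k t i)) [0..<Suc k]"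
    by (rule nth_equalityI) (auto simp: path_vertex_def nth_append nth_Cons split: nat.split)
  then have "path_arcs (s # [l..<l + k] @ [t]) = (\<lambda>i. (if i = 0 then s else l + (i - 1), path_vertex l k t i)) ` {0..<Suc k}"
    by (simp add: path_arcs_def del: upt_Suc)
  also have "{0..<Suc k} = insert 0 (Suc ` {..<k})"
    by (simp add: atLeast0LessThan lessThan_Suc_eq_insert_0)
  finally show ?thesis by (simp add: image_image)
qed

lemma parcs_theta: "parcs (theta a b c) =
   insert (0, path_vertex 2 a 1 0) (insert (0, path_vertex (2 + a) b 1 0) (insert (1, path_vertex (2 + a + b) c 0 0)
    ((\<lambda>i. (2 + i, path_vertex 2 a 1 (Suc i))) ` {..<a} \<union>
     (\<lambda>i. (2 + a + i, path_vertex (2 + a) b 1 (Suc i))) ` {..<b} \<union>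
     (\<lambda>i. (2 + a + b + i, path_vertex (2 + a + b) c 0 (Suc i))) ` {..<c})))"
  unfolding theta_def pair_pre_digraph.select_convs path_arcs_interval by blast

text \<open>
  The defining conditions of a complementarity eigenvector, with the orthogonality condition split
  into one complementarity condition for each coordinate.
\<close>

definition comp_eigenvector :: "nat \<Rightarrow> nat rel \<Rightarrow> real \<Rightarrow> (nat \<Rightarrow> real) \<Rightarrow> bool" where
  "comp_eigenvector n E \<mu> x \<longleftrightarrow> (\<forall>i<n. 0 \<le> x i) \<and> (\<exists>i<n. x i \<noteq> 0) \<and>
    (\<forall>i<n. \<mu> * x i \<le> (\<Sum>j | j < n \<and> (i, j) \<in> E. x j) \<and>
       (x i = 0 \<or> \<mu> * x i = (\<Sum>j | j < n \<and> (i, j) \<in> E. x j)))"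

lemma mem_spectrum_iff_comp_eigenvector:
  fixes G :: "nat pair_pre_digraph"
  assumes V: "pverts G = {0..<n}"
  shows "\<mu> \<in> complementarity_spectrum (with_proj G) \<longleftrightarrow> (\<exists>x. comp_eigenvector n (parcs G) \<mu> x)"
proof -
  let ?A = "adjacency_matrix (with_proj G) [0..<n]"
  have dim[simp]: "dim_row ?A = n" "dim_col ?A = n" by (auto simp: adjacency_matrix_def)
  have "vertex_labelling (with_proj G) [0..<n]" by (simp add: vertex_labelling_def V)
  then have spec: "\<mu> \<in> complementarity_spectrum (with_proj G) \<longleftrightarrow> complementarity_eigenvalue ?A \<mu>"
    by (simp add: complementarity_spectrum_labelling)
  have row: "(?A *\<^sub>v vec n x) $ i = (\<Sum>j | j < n \<and> (i, j) \<in> parcs G. x j)" if "i < n" for x i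
  proof -
    have "(?A *\<^sub>v vec n x) $ i = (\<Sum>j = 0..<n. if (i, j) \<in> parcs G then x j else 0)"
      using that by (auto simp: adjacency_matrix_def scalar_prod_def intro!: sum.cong)
    also have "\<dots> = (\<Sum>j | j < n \<and> (i, j) \<in> parcs G. x j)"
      by (subst sum.inter_filter[symmetric]) (auto intro!: sum.cong)
    finally show ?thesis .
  qed
  have conds: "vec n x \<noteq> 0\<^sub>v n \<and> 0\<^sub>v n \<le> vec n x \<and> \<mu> \<cdot>\<^sub>v vec n x \<le> ?A *\<^sub>v vec n x \<and>
      scalar_prod (vec n x) (?A *\<^sub>v vec n x - \<mu> \<cdot>\<^sub>v vec n x) = 0 \<longleftrightarrow> comp_eigenvector n (parcs G) \<mu> x" for x
  proof -
    let ?S = "\<lambda>i. \<Sum>j | j < n \<and> (i, j) \<in> parcs G. x j"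
    have nz: "vec n x \<noteq> 0\<^sub>v n \<longleftrightarrow> (\<exists>i<n. x i \<noteq> 0)"
      by (auto simp: vec_eq_iff)
    have nn: "0\<^sub>v n \<le> vec n x \<longleftrightarrow> (\<forall>i<n. 0 \<le> x i)"
      by (auto simp: less_eq_vec_def)
    have le: "\<mu> \<cdot>\<^sub>v vec n x \<le> ?A *\<^sub>v vec n x \<longleftrightarrow> (\<forall>i<n. \<mu> * x i \<le> ?S i)"
      by (auto simp: less_eq_vec_def row simp del: index_mult_mat_vec)
    have sp: "scalar_prod (vec n x) (?A *\<^sub>v vec n x - \<mu> \<cdot>\<^sub>v vec n x) = (\<Sum>i = 0..<n. x i * (?S i - \<mu> * x i))"
      unfolding scalar_prod_def by (auto simp: row simp del: index_mult_mat_vec intro!: sum.cong)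
    \<comment> \<open>A scalar product of nonnegative vectors vanishes only if every summand does.\<close>
    have compl: "(\<Sum>i = 0..<n. x i * (?S i - \<mu> * x i)) = 0 \<longleftrightarrow> (\<forall>i<n. x i = 0 \<or> \<mu> * x i = ?S i)"
      if "\<forall>i<n. 0 \<le> x i" "\<forall>i<n. \<mu> * x i \<le> ?S i"
      using that by (subst sum_nonneg_eq_0_iff) auto
    show ?thesis
      unfolding nz nn le sp comp_eigenvector_def using compl by blast
  qed
  have "complementarity_eigenvalue ?A \<mu> \<longleftrightarrow> (\<exists>v \<in> carrier_vec n. v \<noteq> 0\<^sub>v n \<and> 0\<^sub>v n \<le> v \<and>
      \<mu> \<cdot>\<^sub>v v \<le> ?A *\<^sub>v v \<and> scalar_prod v (?A *\<^sub>v v - \<mu> \<cdot>\<^sub>v v) = 0)"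
    by (simp add: complementarity_eigenvalue_def)
  also have "\<dots> \<longleftrightarrow> (\<exists>x. comp_eigenvector n (parcs G) \<mu> x)"
  proof
    assume "\<exists>v \<in> carrier_vec n. v \<noteq> 0\<^sub>v n \<and> 0\<^sub>v n \<le> v \<and>
      \<mu> \<cdot>\<^sub>v v \<le> ?A *\<^sub>v v \<and> scalar_prod v (?A *\<^sub>v v - \<mu> \<cdot>\<^sub>v v) = 0"
    then obtain v where v: "v \<in> carrier_vec n" "v \<noteq> 0\<^sub>v n \<and> 0\<^sub>v n \<le> v \<and>
      \<mu> \<cdot>\<^sub>v v \<le> ?A *\<^sub>v v \<and> scalar_prod v (?A *\<^sub>v v - \<mu> \<cdot>\<^sub>v v) = 0" by blast
    have "v = vec n (($) v)" using v(1) by auto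
    then show "\<exists>x. comp_eigenvector n (parcs G) \<mu> x" using v(2) conds by metis
  next
    assume "\<exists>x. comp_eigenvector n (parcs G) \<mu> x"
    then show "\<exists>v \<in> carrier_vec n. v \<noteq> 0\<^sub>v n \<and> 0\<^sub>v n \<le> v \<and>
      \<mu> \<cdot>\<^sub>v v \<le> ?A *\<^sub>v v \<and> scalar_prod v (?A *\<^sub>v v - \<mu> \<cdot>\<^sub>v v) = 0"
      using conds vec_carrier by metis
  qed
  finally show ?thesis using spec by simp
qed

text \<open>
  The condition at one vertex: \<open>s\<close> is the coordinate there and \<open>t\<close> the sum of the coordinates of its
  out-neighbours.
\<close>

definition compl_at :: "real \<Rightarrow> real \<Rightarrow> real \<Rightarrow> bool" where
  "compl_at \<mu> s t \<longleftrightarrow> \<mu> * s \<le> t \<and> (s = 0 \<or> \<mu> * s = t)"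

text \<open>
  Along a path of vertices with one out-neighbour each, a nonzero coordinate forces equality in the
  condition at its vertex, hence the next coordinate is nonzero too.
\<close>

lemma path_propagation:
  assumes "\<mu> > 0" "\<And>i. i < k \<Longrightarrow> compl_at \<mu> (y i) (y (Suc i))"
  shows "y 0 = 0 \<or> \<mu> ^ k * y 0 = y k"
  using assms(2)
proof (induction k)
  case (Suc k)
  then have "y 0 = 0 \<or> \<mu> ^ k * y 0 = y k" "compl_at \<mu> (y k) (y (Suc k))" by auto
  then show ?case using assms(1) by (auto simp: compl_at_def mult.assoc)
qed simp

lemma path_vertex_simps: "i < k \<Longrightarrow> path_vertex l k t i = l + i" "\<not> i < k \<Longrightarrow> path_vertex l k t i = t"
  by (auto simp: path_vertex_def)

lemma all_theta_vertices:
  fixes a b c :: nat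
  shows "(\<forall>v<a + b + c + 2. P v) \<longleftrightarrow> P 0 \<and> P 1 \<and> (\<forall>i<a. P (2 + i)) \<and> (\<forall>i<b. P (2 + a + i))
    \<and> (\<forall>i<c. P (2 + a + b + i))"
proof (intro iffI allI impI)
  fix v
  assume P: "P 0 \<and> P 1 \<and> (\<forall>i<a. P (2 + i)) \<and> (\<forall>i<b. P (2 + a + i)) \<and> (\<forall>i<c. P (2 + a + b + i))"
    and v: "v < a + b + c + 2"
  consider "v = 0" | "v = 1" | i where "v = 2 + i" "i < a" | i where "v = 2 + a + i" "i < b"
    | i where "v = 2 + a + b + i" "i < c"
  proof -
    have "v = 0 \<or> v = 1 \<or> (2 \<le> v \<and> v < 2 + a) \<or> (2 + a \<le> v \<and> v < 2 + a + b)
        \<or> (2 + a + b \<le> v \<and> v < 2 + a + b + c)"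
      using v by linarith
    then show thesis
      using that by (elim disjE conjE) (auto dest!: le_Suc_ex)
  qed
  then show "P v" using P by cases auto
qed auto

text \<open>
  The assumption \<open>0 < b\<close> makes the two out-neighbours of the vertex 0 distinct.
\<close>

lemma comp_eigenvector_theta:
  fixes a b c :: nat
  assumes b: "0 < b"
  defines "A \<equiv> path_vertex 2 a 1" and "B \<equiv> path_vertex (2 + a) b 1" and "C \<equiv> path_vertex (2 + a + b) c 0"
  shows "comp_eigenvector (a + b + c + 2) (parcs (theta a b c)) \<mu> x \<longleftrightarrow>
    (\<forall>v<a + b + c + 2. 0 \<le> x v) \<and> (\<exists>v<a + b + c + 2. x v \<noteq> 0) \<and>
    compl_at \<mu> (x 0) (x (A 0) + x (B 0)) \<and> compl_at \<mu> (x 1) (x (C 0)) \<and>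
    (\<forall>i<a. compl_at \<mu> (x (A i)) (x (A (Suc i)))) \<and>
    (\<forall>i<b. compl_at \<mu> (x (B i)) (x (B (Suc i)))) \<and>
    (\<forall>i<c. compl_at \<mu> (x (C i)) (x (C (Suc i))))"
proof -
  let ?n = "a + b + c + 2" and ?E = "parcs (theta a b c)"
  let ?N = "\<lambda>v. {j. j < ?n \<and> (v, j) \<in> ?E}"
  have bound: "A i < ?n" "B i < ?n" "C i < ?n" for i
    by (auto simp: A_def B_def C_def path_vertex_def)
  note E = parcs_theta[of a b c, folded A_def B_def C_def]
  have N0: "?N 0 = {A 0, B 0}" and N1: "?N 1 = {C 0}"
    using bound by (auto simp: E)
  have NA: "?N (2 + i) = {A (Suc i)}" if "i < a" for i
    using bound that by (auto simp: E)
  have NB: "?N (2 + a + i) = {B (Suc i)}" if "i < b" for i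
    using bound that by (auto simp: E)
  have NC: "?N (2 + a + b + i) = {C (Suc i)}" if "i < c" for i
    using bound that by (auto simp: E)
  have "A 0 \<noteq> B 0" using b by (auto simp: A_def B_def path_vertex_def)
  have "comp_eigenvector ?n ?E \<mu> x \<longleftrightarrow> (\<forall>v<?n. 0 \<le> x v) \<and> (\<exists>v<?n. x v \<noteq> 0) \<and>
      (\<forall>v<?n. compl_at \<mu> (x v) (sum x (?N v)))"
    by (simp add: comp_eigenvector_def compl_at_def)
  also have "(\<forall>v<?n. compl_at \<mu> (x v) (sum x (?N v))) \<longleftrightarrow>
    compl_at \<mu> (x 0) (x (A 0) + x (B 0)) \<and> compl_at \<mu> (x 1) (x (C 0)) \<and>
    (\<forall>i<a. compl_at \<mu> (x (2 + i)) (x (A (Suc i)))) \<and>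
    (\<forall>i<b. compl_at \<mu> (x (2 + a + i)) (x (B (Suc i)))) \<and>
    (\<forall>i<c. compl_at \<mu> (x (2 + a + b + i)) (x (C (Suc i))))"
    unfolding all_theta_vertices[of a b c "\<lambda>v. compl_at \<mu> (x v) (sum x (?N v))"]
    using \<open>A 0 \<noteq> B 0\<close> by (simp only: N0 N1 NA NB NC cong: imp_cong) simp
  finally show ?thesis
    by (simp only: A_def B_def C_def path_vertex_simps cong: imp_cong)
qed

text \<open>
  Neither branch vertex can have coordinate 0, since zeros travel backwards along all three paths
  and then reach everything. So the path from 1 to 0 carries a geometric sequence. Each of the other two
  paths either carries a geometric sequence as well or starts with the coordinate 0. If both are
  geometric, the condition at 0 is the equation on the right. If one starts with 0, the closed walk
  through the other one alone would give a power of \<open>1/\<mu>\<close> with the value 1, which is impossible for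
  \<open>\<mu> > 1\<close>. Conversely, the three geometric sequences fit together to a positive eigenvector.
\<close>

lemma spectrum_theta_gt_one:
  assumes b: "0 < b" and mu: "1 < \<mu>"
  shows "\<mu> \<in> complementarity_spectrum (with_proj (theta a b c)) \<longleftrightarrow>
    inverse \<mu> ^ (a + c + 2) + inverse \<mu> ^ (b + c + 2) = 1"
proof -
  define A where "A = path_vertex 2 a 1"
  define B where "B = path_vertex (2 + a) b 1"
  define C where "C = path_vertex (2 + a + b) c 0"
  let ?n = "a + b + c + 2"
  note defs = A_def B_def C_def
  have ends: "A a = 1" "B b = 1" "C c = 0" by (auto simp: defs path_vertex_def)
  have bound: "A i < ?n" "B i < ?n" "C i < ?n" for i
    by (auto simp: defs path_vertex_def)
  have "\<mu> \<in> complementarity_spectrum (with_proj (theta a b c)) \<longleftrightarrow>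
      (\<exists>x. comp_eigenvector ?n (parcs (theta a b c)) \<mu> x)"
    by (rule mem_spectrum_iff_comp_eigenvector) (simp add: theta_def)
  also have "\<dots> \<longleftrightarrow> inverse \<mu> ^ (a + c + 2) + inverse \<mu> ^ (b + c + 2) = 1"
  proof
    assume "\<exists>x. comp_eigenvector ?n (parcs (theta a b c)) \<mu> x"
    then obtain x where "comp_eigenvector ?n (parcs (theta a b c)) \<mu> x" ..
    note this[unfolded comp_eigenvector_theta[OF b, where a = a and c = c, folded defs]]
    then have nonneg: "\<And>v. v < ?n \<Longrightarrow> 0 \<le> x v" and nz: "\<exists>v<?n. x v \<noteq> 0"
      and at0: "compl_at \<mu> (x 0) (x (A 0) + x (B 0))" and at1: "compl_at \<mu> (x 1) (x (C 0))"
      and atA: "\<And>i. i < a \<Longrightarrow> compl_at \<mu> (x (A i)) (x (A (Suc i)))"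
      and atB: "\<And>i. i < b \<Longrightarrow> compl_at \<mu> (x (B i)) (x (B (Suc i)))"
      and atC: "\<And>i. i < c \<Longrightarrow> compl_at \<mu> (x (C i)) (x (C (Suc i)))"
      by simp_all
    have A0: "x (A 0) = 0 \<or> \<mu> ^ a * x (A 0) = x 1"
      using path_propagation[of \<mu> a "\<lambda>i. x (A i)"] mu atA by (simp add: ends)
    have B0: "x (B 0) = 0 \<or> \<mu> ^ b * x (B 0) = x 1"
      using path_propagation[of \<mu> b "\<lambda>i. x (B i)"] mu atB by (simp add: ends)
    have C0: "x (C 0) = 0 \<or> \<mu> ^ c * x (C 0) = x 0"
      using path_propagation[of \<mu> c "\<lambda>i. x (C i)"] mu atC by (simp add: ends)
    show "inverse \<mu> ^ (a + c + 2) + inverse \<mu> ^ (b + c + 2) = 1"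
    proof -
      have zero_end: "s = 0" if "compl_at \<mu> s t" "t = 0" "0 \<le> s" for s t
        using that mu by (auto simp: compl_at_def mult_le_0_iff)
      have path_zero: "\<forall>i\<le>k. y i = 0"
        if "\<And>i. i < k \<Longrightarrow> compl_at \<mu> (y i) (y (Suc i))" "\<And>i. 0 \<le> y i" "y k = 0" for y k
      proof (intro allI impI)
        fix i assume "i \<le> k"
        then show "y i = 0"
          by (induction rule: inc_induct) (use that zero_end in blast)+
      qed
      have zero_iff: "x 0 = 0 \<longleftrightarrow> x 1 = 0"
      proof
        assume "x 0 = 0"
        then have "x (C 0) = 0"
          using path_zero[of c "\<lambda>i. x (C i)"] atC nonneg bound by (simp add: ends)
        then show "x 1 = 0" using zero_end[OF at1] nonneg by simp
      next
        assume "x 1 = 0"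
        then have "x (A 0) = 0" "x (B 0) = 0"
          using path_zero[of a "\<lambda>i. x (A i)"] path_zero[of b "\<lambda>i. x (B i)"] atA atB nonneg bound
          by (simp_all add: ends)
        then show "x 0 = 0" using zero_end[OF at0] nonneg by simp
      qed
      have "x 0 \<noteq> 0"
      proof
        assume x0: "x 0 = 0"
        then have x1: "x 1 = 0" using zero_iff by simp
        have zeros: "\<forall>i\<le>a. x (A i) = 0" "\<forall>i\<le>b. x (B i) = 0" "\<forall>i\<le>c. x (C i) = 0"
          using path_zero[of a "\<lambda>i. x (A i)"] path_zero[of b "\<lambda>i. x (B i)"]
            path_zero[of c "\<lambda>i. x (C i)"] atA atB atC nonneg bound x0 x1
          by (simp_all add: ends)
        have "\<forall>i<a. x (2 + i) = 0" "\<forall>i<b. x (2 + a + i) = 0" "\<forall>i<c. x (2 + a + b + i) = 0"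
          using zeros unfolding defs by (metis less_imp_le path_vertex_simps(1))+
        then have "\<forall>v<?n. x v = 0"
          unfolding all_theta_vertices[of a b c "\<lambda>v. x v = 0"] using x0 x1 by blast
        then show False using nz by blast
      qed
      then have x0: "x 0 > 0" and "x 1 > 0" using nonneg[of 0] nonneg[of 1] zero_iff by auto
      define r where "r = inverse \<mu>"
      have r: "0 < r" "r < 1" "\<mu> = inverse r" using mu by (auto simp: r_def inverse_less_1_iff)
      have "\<mu> * x 1 = x (C 0)" "\<mu> ^ c * x (C 0) = x 0"
        using \<open>x 1 > 0\<close> at1 C0 mu by (auto simp: compl_at_def)
      then have x1: "x 1 = r ^ (c + 1) * x 0"
        using r(1) by (auto simp: r(3) power_inverse field_simps)
      have "\<mu> * x 0 = x (A 0) + x (B 0)" using x0 at0 by (auto simp: compl_at_def)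
      then have sum: "x 0 = r * (x (A 0) + x (B 0))" using r by (simp add: field_simps)
      have "x (A 0) = 0 \<or> x (A 0) = r ^ a * x 1" "x (B 0) = 0 \<or> x (B 0) = r ^ b * x 1"
        using A0 B0 r(1) by (auto simp: r(3) power_inverse field_simps)
      then have "\<exists>\<alpha> \<beta>. x (A 0) = \<alpha> * (r ^ a * x 1) \<and> x (B 0) = \<beta> * (r ^ b * x 1) \<and> \<alpha> \<in> {0,1} \<and> \<beta> \<in> {0,1}"
        by (metis insertCI mult_1 mult_zero_left)
      \<comment> \<open>The factors \<open>\<alpha>\<close> and \<open>\<beta>\<close> record which of the two paths from 0 to 1 carry a nonzero sequence.\<close>
      then obtain \<alpha> \<beta> where \<alpha>\<beta>: "x (A 0) = \<alpha> * (r ^ a * x 1)" "x (B 0) = \<beta> * (r ^ b * x 1)"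
        "\<alpha> = 0 \<or> \<alpha> = 1" "\<beta> = 0 \<or> \<beta> = 1" by blast
      have "1 * x 0 = (\<alpha> * r ^ (a + c + 2) + \<beta> * r ^ (b + c + 2)) * x 0"
        using sum unfolding \<alpha>\<beta>(1,2) x1 by (simp add: power_add algebra_simps)
      then have one: "\<alpha> * r ^ (a + c + 2) + \<beta> * r ^ (b + c + 2) = 1"
        using x0 by (metis less_irrefl mult_right_cancel)
      have "r ^ (k + 2) < 1" for k
        using r power_strict_decreasing[of 0 "k + 2" r] by simp
      from this[of "a + c"] this[of "b + c"] show ?thesis
        using one \<alpha>\<beta>(3,4) by (auto simp: r_def)
    qed
  next
    assume eq: "inverse \<mu> ^ (a + c + 2) + inverse \<mu> ^ (b + c + 2) = 1"
    define r where "r = inverse \<mu>"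
    have r: "r > 0" "\<mu> * r = 1" using mu by (auto simp: r_def)
    define x where "x v = (if v = 0 then 1 else if v = 1 then r ^ (c + 1)
      else if v < 2 + a then r ^ (a + 2 - v) * r ^ (c + 1)
      else if v < 2 + a + b then r ^ (a + b + 2 - v) * r ^ (c + 1) else r ^ (?n - v))" for v
    have xA: "x (A i) = r ^ (a - i) * r ^ (c + 1)" if "i \<le> a" for i
      using that by (auto simp: x_def defs path_vertex_def)
    have xB: "x (B i) = r ^ (b - i) * r ^ (c + 1)" if "i \<le> b" for i
      using that by (auto simp: x_def defs path_vertex_def)
    have xC: "x (C i) = r ^ (c - i)" if "i \<le> c" for i
      using that by (auto simp: x_def defs path_vertex_def)
    have step: "\<mu> * r ^ (k - i) = r ^ (k - Suc i)" if "i < k" for k i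
    proof -
      have "k - i = Suc (k - Suc i)" using that by simp
      then show ?thesis using r(2) by (simp add: mult.assoc[symmetric])
    qed
    have "\<mu> * x 0 = \<mu> * (r ^ (a + c + 2) + r ^ (b + c + 2))"
      using eq by (simp add: x_def r_def)
    also have "\<dots> = (\<mu> * r) * (r ^ a * r ^ (c + 1) + r ^ b * r ^ (c + 1))"
      by (simp add: power_add algebra_simps)
    also have "\<dots> = x (A 0) + x (B 0)"
      by (simp add: xA xB r)
    finally have at0: "\<mu> * x 0 = x (A 0) + x (B 0)" .
    have at1: "\<mu> * x 1 = x (C 0)"
      using r(2) by (simp add: xC) (simp add: x_def mult.assoc[symmetric])
    have "\<forall>v. 0 \<le> x v" "x 0 \<noteq> 0" using r(1) by (auto simp: x_def)
    moreover have "\<forall>i<a. \<mu> * x (A i) = x (A (Suc i))" "\<forall>i<b. \<mu> * x (B i) = x (B (Suc i))"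
      "\<forall>i<c. \<mu> * x (C i) = x (C (Suc i))"
      by (auto simp: xA xB xC mult.assoc[symmetric] step)
    ultimately have "comp_eigenvector ?n (parcs (theta a b c)) \<mu> x"
      unfolding comp_eigenvector_theta[OF b, where a = a and c = c, folded defs]
      using at0 at1 by (auto simp: compl_at_def)
    then show "\<exists>x. comp_eigenvector ?n (parcs (theta a b c)) \<mu> x" by blast
  qed
  finally show ?thesis .
qed

lemma spectrum_theta_gt_one_ex:
  assumes b: "0 < b"
  obtains \<mu> where "1 < \<mu>" "\<mu> \<in> complementarity_spectrum (with_proj (theta a b c))"
proof -
  let ?f = "\<lambda>x::real. x ^ (a + c + 2) + x ^ (b + c + 2)"
  have "\<exists>x\<ge>0. x \<le> 1 \<and> ?f x = 1"
    by (rule IVT') (auto intro!: continuous_intros)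
  then obtain x where x: "0 \<le> x" "x \<le> 1" "?f x = 1" by blast
  moreover from x(3) have "x \<noteq> 0" "x \<noteq> 1" by auto
  ultimately have "1 < inverse x" "?f (inverse (inverse x)) = 1"
    by (auto simp: one_less_inverse)
  then show thesis using that spectrum_theta_gt_one[OF b] by blast
qed

section \<open>Theta digraphs are determined by their spectrum\<close>

text \<open>
  With \<open>p = a + c + 2\<close>, \<open>q = b + c + 2\<close> and likewise for the primed parameters, \<open>p < p'\<close> forces
  \<open>q' < q\<close>, so only the exceptional family of common roots remains: \<open>p' + q' = 5p = q\<close>. But both
  digraphs have the same number of vertices \<open>n\<close>, and \<open>q \<le> n = p' + q' - c' - 2 < p' + q'\<close>.
\<close>

lemma theta_equation_smaller_exponent:
  fixes x :: real
  assumes "a \<le> b" "a' \<le> b'" "a + b + c = a' + b' + c'" "0 < x" "x < 1"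
    and eq: "x ^ (a + c + 2) + x ^ (b + c + 2) = 1" "x ^ (a' + c' + 2) + x ^ (b' + c' + 2) = 1"
  shows "\<not> a + c < a' + c'"
proof
  assume less: "a + c < a' + c'"
  have "x ^ (b + c + 2) < x ^ (b' + c' + 2)"
    using less power_strict_decreasing[of "a + c + 2" "a' + c' + 2" x] assms by linarith
  then have "b' + c' < b + c"
    using assms by (simp add: power_strict_decreasing_iff)
  then have "a' + c' + 2 = 2 * (a + c + 2) \<and> b' + c' + 2 = 3 * (a + c + 2) \<and> b + c + 2 = 5 * (a + c + 2)"
    using less assms by (intro trinomials_common_root[where x = x]) auto
  then show False using assms(3) by linarith
qed

lemma theta_parameters_unique:
  fixes x :: real
  assumes "a \<le> b" "a' \<le> b'" "a + b + c = a' + b' + c'" "0 < x" "x < 1"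
    and eq: "x ^ (a + c + 2) + x ^ (b + c + 2) = 1" "x ^ (a' + c' + 2) + x ^ (b' + c' + 2) = 1"
  shows "a = a' \<and> b = b' \<and> c = c'"
proof -
  have p: "a + c = a' + c'"
    using theta_equation_smaller_exponent[of a b a' b' c c' x]
      theta_equation_smaller_exponent[of a' b' a b c' c x] assms by linarith
  then have "x ^ (b + c + 2) = x ^ (b' + c' + 2)" using eq unfolding p by linarith
  then have "b + c + 2 = b' + c' + 2"
    using power_strict_decreasing[of "b + c + 2" "b' + c' + 2" x]
      power_strict_decreasing[of "b' + c' + 2" "b + c + 2" x] assms(4,5)
    by (cases "b + c + 2" "b' + c' + 2" rule: linorder_cases) auto
  with p assms(3) show ?thesis by linarith
qed

theorem theorem4p11:
  fixes D :: "('a, 'b) pre_digraph" and H :: "('c, 'd) pre_digraph" and n :: nat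
  assumes "theta_digraph D" and "theta_digraph H"
    and "card (verts D) = n" and "card (verts H) = n"
    and "complementarity_spectrum D = complementarity_spectrum H"
  shows "digraph_iso D H"
proof -
  have wf_theta: "wf_digraph (with_proj (theta i j k))" for i j k
    using digraph_theta by (simp add: digraph_def fin_digraph_def)
  have card_iso: "card (verts G) = card (verts K)" if "digraph_iso G K"
    for G :: "('e, 'f) pre_digraph" and K :: "('g, 'h) pre_digraph"
    using that by (auto simp: digraph_iso_def pre_digraph.digraph_isomorphism_def card_image)
  obtain a b c where abc: "a \<le> b" "0 < b" and D: "digraph_iso D (with_proj (theta a b c))"
    and wfD: "wf_digraph D"
    using assms(1) by (auto simp: theta_digraph_def digraph_def fin_digraph_def)
  obtain a' b' c' where abc': "a' \<le> b'" "0 < b'" and H: "digraph_iso H (with_proj (theta a' b' c'))"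
    and wfH: "wf_digraph H"
    using assms(2) by (auto simp: theta_digraph_def digraph_def fin_digraph_def)
  have size: "a + b + c = a' + b' + c'"
    using card_iso[OF D] card_iso[OF H] assms(3,4) by (simp only: card_verts_theta)
  have spec: "complementarity_spectrum (with_proj (theta a b c)) =
      complementarity_spectrum (with_proj (theta a' b' c'))"
    using assms(5) digraph_iso_spectrum_eq[OF wfD wf_theta D] digraph_iso_spectrum_eq[OF wfH wf_theta H]
    by simp
  obtain \<mu> where \<mu>: "1 < \<mu>" "\<mu> \<in> complementarity_spectrum (with_proj (theta a b c))"
    using spectrum_theta_gt_one_ex[OF abc(2)] by blast
  have "a = a' \<and> b = b' \<and> c = c'"
  proof (rule theta_parameters_unique[OF abc(1) abc'(1) size])
    show "0 < inverse \<mu>" "inverse \<mu> < 1" using \<mu>(1) by (auto simp: inverse_less_1_iff)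
    show "inverse \<mu> ^ (a + c + 2) + inverse \<mu> ^ (b + c + 2) = 1"
      using \<mu> spectrum_theta_gt_one[OF abc(2)] by blast
    show "inverse \<mu> ^ (a' + c' + 2) + inverse \<mu> ^ (b' + c' + 2) = 1"
      using \<mu> spec spectrum_theta_gt_one[OF abc'(2)] by blast
  qed
  then show ?thesis
    using digraph_iso_trans[OF D] digraph_iso_swap[OF wfH H] by simp
qed

end
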